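(* Let $\mathbf{M}$ be an $n\times n$ real matrix such that $\mathbf{M}_\sigma$ is $\sigma$-stable, with point of stability $\sigma_0>0$. Suppose that the leading eigenvalue of $\mathbf{M}_{\sigma_0}$ is real and equal to $0$, i.e. $\operatorname{Re}(\lambda_{\max(\mathbf{M}_{\sigma_0})})=0$ and $\operatorname{Im}(\lambda_{\max(\mathbf{M}_{\sigma_0})})=0$. Then $\max(\Omega)=\sigma_0$, where $\Omega$ is the set of all real roots of all the polynomials $p_0,\dots,p_{n-1}$.
   Context: Let $\mathbf{M}=(m_{i,j})$ be an $n\times n$ matrix with real entries and let $\mathbf{D}$ be the diagonal matrix consisting of the diagonal entries of $\mathbf{M}$. For $\sigma\in\mathbb{C}$ put $\mathbf{M}_\sigma=\mathbf{M}-(1-\sigma)\mathbf{D}$, i.e. $\mathbf{M}_\sigma$ is obtained from $\mathbf{M}$ by multiplying each diagonal entry by $\sigma$ and leaving the off-diagonal entries unchanged. Write $\lambda_{\max(\mathbf{M}_\sigma)}$ for a maximal (largest real part), or leading, eigenvalue of $\mathbf{M}_\sigma$. Definition ($\sigma$-stable). $\mathbf{M}_\sigma$ is called $\sigma$-stable if there exists a real number $\sigma_0>0$ such that $\operatorname{Re}(\lambda_{\max(\mathbf{M}_{\sigma_0})})=0$ and $\operatorname{Re}(\lambda_{\max(\mathbf{M}_{\sigma})})<0$ for every $\sigma\in\mathbb{C}$ with $\operatorname{Re}(\sigma)>\sigma_0$. Such a $\sigma_0$ is called the point of stability. The characteristic polynomial of $\mathbf{M}_\sigma$ is the monic polynomial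 $P_{\mathbf{M}_\sigma}(x)=\det(x\mathbf{I}-\mathbf{M}_\sigma)=\sum_{i=0}^n p_i(\sigma)x^i$, with $p_n=1$, where each $p_i(\sigma)$ is a polynomial in $\sigma$ of degree at most $n-i$ with real coefficients. The set $\Omega\subset\mathbb{R}$ consists of all real roots (in $\sigma$) of all the polynomials $p_0,p_1,\dots,p_{n-1}$. *)

theory Defs
  imports Complex_Main "Jordan_Normal_Form.Char_Poly"
begin

definition diag_part :: "'a :: zero mat \<Rightarrow> 'a mat" where
  "diag_part A = mat_diag (dim_row A) (\<lambda>i. A $$ (i, i))"

text \<open>The operation \<open>M - (1 - s) D\<close> is defined over any commutative ring, so that \<open>s\<close> can be
  a complex number as well as the indeterminate of a polynomial ring.\<close>

definition scale_diag :: "'a :: comm_ring_1 \<Rightarrow> 'a mat \<Rightarrow> 'a mat" where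
  "scale_diag s A = A - (1 - s) \<cdot>\<^sub>m diag_part A"

definition sigma_mat :: "real mat \<Rightarrow> complex \<Rightarrow> complex mat" where
  "sigma_mat M \<sigma> = scale_diag \<sigma> (map_mat complex_of_real M)"

text \<open>A leading eigenvalue need not be unique, but its real part is; hence a predicate.\<close>

definition leading_eigenvalue :: "complex mat \<Rightarrow> complex \<Rightarrow> bool" where
  "leading_eigenvalue A l \<longleftrightarrow>
     eigenvalue A l \<and> (\<forall>\<mu>. eigenvalue A \<mu> \<longrightarrow> Re \<mu> \<le> Re l)"

definition stability_point :: "real mat \<Rightarrow> real \<Rightarrow> bool" where
  "stability_point M \<sigma>\<^sub>0 \<longleftrightarrow> \<sigma>\<^sub>0 > 0 \<and>
     (\<exists>l. leading_eigenvalue (sigma_mat M (complex_of_real \<sigma>\<^sub>0)) l \<and> Re l = 0) \<and>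
     (\<forall>\<sigma>::complex. Re \<sigma> > \<sigma>\<^sub>0 \<longrightarrow> (\<exists>l. leading_eigenvalue (sigma_mat M \<sigma>) l \<and> Re l < 0))"

definition sigma_stable :: "real mat \<Rightarrow> bool" where
  "sigma_stable M \<longleftrightarrow> (\<exists>\<sigma>\<^sub>0. stability_point M \<sigma>\<^sub>0)"

text \<open>The coefficient \<open>p\<^sub>i\<close> as a polynomial in \<open>\<sigma>\<close>: the characteristic polynomial is formed over
  the ring of real polynomials, with \<open>\<sigma>\<close> its indeterminate \<open>[:0, 1:]\<close>.\<close>

definition sigma_coeff :: "real mat \<Rightarrow> nat \<Rightarrow> real poly" where
  "sigma_coeff M i = coeff (char_poly (scale_diag [:0, 1:] (map_mat (\<lambda>a. [:a:]) M))) i"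

definition Omega :: "real mat \<Rightarrow> real set" where
  "Omega M = {\<omega>. \<exists>i < dim_row M. poly (sigma_coeff M i) \<omega> = 0}"

lemma scale_diag_index:
  assumes "A \<in> carrier_mat n n" "i < n" "j < n"
  shows "scale_diag s A $$ (i, j) = (if i = j then s * A $$ (i, j) else A $$ (i, j))"
  using assms by (auto simp: scale_diag_def diag_part_def mat_diag_def algebra_simps)

lemma scale_diag_carrier:
  assumes "A \<in> carrier_mat n n"
  shows "scale_diag s A \<in> carrier_mat n n"
  using assms by (auto simp: scale_diag_def diag_part_def mat_diag_def)

lemma map_poly_pCons_of_real:
  "map_poly complex_of_real (pCons a p) = pCons (complex_of_real a) (map_poly complex_of_real p)"
  by (intro poly_eqI) (simp add: coeff_map_poly coeff_pCons split: nat.split)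

text \<open>Specialising the indeterminate recovers the characteristic polynomial at each complex \<open>\<sigma>\<close>.\<close>

lemma coeff_char_poly_sigma_mat:
  assumes M: "M \<in> carrier_mat n n"
  shows "coeff (char_poly (sigma_mat M \<sigma>)) i = poly (map_poly complex_of_real (sigma_coeff M i)) \<sigma>"
proof -
  define h where "h = (\<lambda>p. poly (map_poly complex_of_real p) \<sigma>)"
  interpret r: map_poly_comm_ring_hom complex_of_real
    by unfold_locales auto
  interpret h: comm_ring_hom h
    unfolding h_def by unfold_locales (auto simp: r.hom_add r.hom_mult)
  let ?A = "scale_diag [:0, 1:] (map_mat (\<lambda>a. [:a:]) M)"
  have A: "?A \<in> carrier_mat n n"
    using M by (intro scale_diag_carrier) auto
  have "sigma_mat M \<sigma> = map_mat h ?A"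
  proof (rule eq_matI)
    fix i j
    assume "i < dim_row (map_mat h ?A)" "j < dim_col (map_mat h ?A)"
    hence ij: "i < n" "j < n" using A by auto
    show "sigma_mat M \<sigma> $$ (i, j) = map_mat h ?A $$ (i, j)"
      using M A ij by (auto simp: sigma_mat_def scale_diag_index[of _ n] h_def map_poly_pCons_of_real)
  qed (use M A scale_diag_carrier[of "map_mat complex_of_real M" n \<sigma>] in
      \<open>auto simp: sigma_mat_def\<close>)
  thus ?thesis
    using h.char_poly_hom[OF A] by (simp add: sigma_coeff_def h_def coeff_map_poly)
qed

end

theory Submission
  imports Defs "HOL-Computational_Algebra.Fundamental_Theorem_Algebra"
begin

text \<open>For real \<open>\<sigma> > \<sigma>\<^sub>0\<close> all zeros of the characteristic polynomial of \<open>M\<^sub>\<sigma>\<close> lie in the open left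
  half-plane. By the Gauss--Lucas argument the same holds for all its derivatives, so none of
  them vanishes at \<open>0\<close>; hence no coefficient \<open>p\<^sub>i(\<sigma>)\<close> vanishes. This bounds \<open>Omega M\<close>
  by \<open>\<sigma>\<^sub>0\<close> and shows that no \<open>p\<^sub>i\<close> is the zero polynomial. The eigenvalue \<open>0\<close> at \<open>\<sigma>\<^sub>0\<close>
  gives \<open>p\<^sub>0(\<sigma>\<^sub>0) = 0\<close>.\<close>

text \<open>These are the Hurwitz-stable polynomials. The zero polynomial is excluded, since it
  vanishes at 0.\<close>

definition left_half_plane_zeros :: "complex poly \<Rightarrow> bool" where
  "left_half_plane_zeros p \<longleftrightarrow> (\<forall>z. poly p z = 0 \<longrightarrow> Re z < 0)"

text \<open>The logarithmic derivative of the product is the sum of \<open>1 / (z - a)\<close> over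
  \<open>A\<close>. Each summand has positive real part, because \<open>Re (1 / w)\<close> is
  \<open>Re w\<close> divided by the squared modulus of \<open>w\<close>.\<close>

lemma Re_log_deriv_prod_pos:
  assumes "\<forall>a\<in>#A. Re a < 0" "Re z \<ge> 0" "A \<noteq> {#}"
  shows "Re (poly (pderiv (\<Prod>a\<in>#A. [:-a, 1:])) z / poly (\<Prod>a\<in>#A. [:-a, 1:]) z) > 0"
  using assms
proof (induction A)
  case (add a A)
  let ?p = "\<Prod>a\<in>#A. [:-a, 1:]"
  have az: "Re (z - a) > 0" using add.prems by simp
  hence "z - a \<noteq> 0" by auto
  have "poly ?p z \<noteq> 0"
    using add.prems by (force simp: poly_prod_mset image_iff)
  have "Re (1 / (z - a)) > 0"
    using az \<open>z - a \<noteq> 0\<close> by (auto simp: Re_divide intro!: divide_pos_pos add_pos_nonneg)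
  \<comment> \<open>Only a weak inequality holds here: for empty \<open>A\<close> the product is 1
    and its logarithmic derivative is 0.\<close>
  moreover have "Re (poly (pderiv ?p) z / poly ?p z) \<ge> 0"
    using add by (cases "A = {#}") (auto intro: less_imp_le)
  moreover have "poly (pderiv ([:-a, 1:] * ?p)) z / poly ([:-a, 1:] * ?p) z
      = 1 / (z - a) + poly (pderiv ?p) z / poly ?p z"
  proof -
    have "poly (pderiv ([:-a, 1:] * ?p)) z = (z - a) * poly (pderiv ?p) z + poly ?p z"
      unfolding pderiv_mult poly_add poly_mult by (simp add: pderiv_pCons)
    moreover have "poly ([:-a, 1:] * ?p) z = (z - a) * poly ?p z"
      unfolding poly_mult by simp
    ultimately show ?thesis
      using \<open>z - a \<noteq> 0\<close> \<open>poly ?p z \<noteq> 0\<close> by (simp add: field_simps)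
  qed
  ultimately show ?case by simp
qed simp

text \<open>Factor \<open>p\<close> into linear factors over the complex numbers. At a zero of
  \<open>pderiv p\<close> outside the open left half-plane the logarithmic derivative would be 0,
  yet its real part is positive there.\<close>

lemma left_half_plane_zeros_pderiv:
  assumes "left_half_plane_zeros p" "degree p > 0"
  shows "left_half_plane_zeros (pderiv p)"
  unfolding left_half_plane_zeros_def
proof (intro allI impI, rule ccontr)
  fix z assume z: "poly (pderiv p) z = 0" "\<not> Re z < 0"
  obtain A where A: "size A = degree p" "p = Polynomial.smult (lead_coeff p) (\<Prod>a\<in>#A. [:-a, 1:])"
    using alg_closed_imp_factorization[of p] assms(2) by fastforce
  let ?q = "\<Prod>a\<in>#A. [:-a, 1:]"
  have "lead_coeff p \<noteq> 0" using assms(2) by auto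
  have "poly p a = 0" if "a \<in># A" for a
    by (subst A(2)) (use that in \<open>auto simp: poly_prod_mset image_iff\<close>)
  hence "\<forall>a\<in>#A. Re a < 0"
    using assms(1) by (auto simp: left_half_plane_zeros_def)
  moreover have "A \<noteq> {#}" using A(1) assms(2) by auto
  \<comment> \<open>A vanishing numerator would make the quotient 0, whose real part is not
    positive.\<close>
  ultimately have "poly (pderiv ?q) z \<noteq> 0"
    using Re_log_deriv_prod_pos[of A z] z(2) by auto
  moreover have "pderiv p = Polynomial.smult (lead_coeff p) (pderiv ?q)"
    by (subst A(2)) (rule pderiv_smult)
  ultimately show False
    using z(1) \<open>lead_coeff p \<noteq> 0\<close> by simp
qed

text \<open>Up to a positive integer factor, coefficient \<open>i\<close> is the value at 0 of the
  \<open>i\<close>-th derivative, and 0 lies outside the open left half-plane.\<close>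

lemma coeff_nonzero_if_left_half_plane_zeros:
  assumes "left_half_plane_zeros p" "i \<le> degree p"
  shows "coeff p i \<noteq> 0"
  using assms
proof (induction i arbitrary: p)
  case 0
  thus ?case by (auto simp: left_half_plane_zeros_def poly_0_coeff_0[symmetric])
next
  case (Suc i)
  have "coeff (pderiv p) i \<noteq> 0"
    using Suc by (intro Suc.IH left_half_plane_zeros_pderiv) (auto simp: degree_pderiv)
  thus ?case by (auto simp: coeff_pderiv)
qed

lemma poly_map_poly_of_real:
  "poly (map_poly complex_of_real p) (complex_of_real x) = complex_of_real (poly p x)"
  by (induction p) (simp_all add: map_poly_pCons_of_real)

lemma sigma_mat_carrier:
  "M \<in> carrier_mat n n \<Longrightarrow> sigma_mat M \<sigma> \<in> carrier_mat n n"
  unfolding sigma_mat_def by (rule scale_diag_carrier) simp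

lemma poly_sigma_coeff_nonzero:
  assumes M: "M \<in> carrier_mat n n" and stab: "stability_point M \<sigma>\<^sub>0"
    and "\<sigma>\<^sub>0 < x" "i < n"
  shows "poly (sigma_coeff M i) x \<noteq> 0"
proof -
  let ?S = "sigma_mat M (complex_of_real x)"
  note S = sigma_mat_carrier[OF M, of "complex_of_real x"]
  obtain m where m: "leading_eigenvalue ?S m" "Re m < 0"
    using stab \<open>\<sigma>\<^sub>0 < x\<close> unfolding stability_point_def by (metis Re_complex_of_real)
  have "left_half_plane_zeros (char_poly ?S)"
    \<comment> \<open>The zeros of the characteristic polynomial are the eigenvalues, and
      \<open>Re m\<close> bounds all their real parts.\<close>
    using m unfolding left_half_plane_zeros_def leading_eigenvalue_def
      eigenvalue_root_char_poly[OF S] by (meson le_less_trans)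
  hence "coeff (char_poly ?S) i \<noteq> 0"
    using degree_monic_char_poly[OF S] \<open>i < n\<close>
    by (intro coeff_nonzero_if_left_half_plane_zeros) auto
  thus ?thesis
    by (simp add: coeff_char_poly_sigma_mat[OF M] poly_map_poly_of_real)
qed

theorem theorem2:
  fixes M :: "real mat" and n :: nat and \<sigma>\<^sub>0 :: real and l :: complex
  assumes "M \<in> carrier_mat n n"
    and "sigma_stable M"
    and "stability_point M \<sigma>\<^sub>0"
    and "leading_eigenvalue (sigma_mat M (complex_of_real \<sigma>\<^sub>0)) l"
    and "Re l = 0" and "Im l = 0"
  shows "finite (Omega M) \<and> Omega M \<noteq> {} \<and> Max (Omega M) = \<sigma>\<^sub>0"
proof -
  let ?S = "sigma_mat M (complex_of_real \<sigma>\<^sub>0)"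
  note S = sigma_mat_carrier[OF assms(1), of "complex_of_real \<sigma>\<^sub>0"]
  note nonzero = poly_sigma_coeff_nonzero[OF assms(1,3)]
  have Omega: "Omega M = (\<Union>i<n. {\<omega>. poly (sigma_coeff M i) \<omega> = 0})"
    using assms(1) by (auto simp: Omega_def)
  have "sigma_coeff M i \<noteq> 0" if "i < n" for i
    \<comment> \<open>Any point beyond \<open>\<sigma>\<^sub>0\<close> would do: one nonzero value
      rules out the zero polynomial.\<close>
    using nonzero[of "\<sigma>\<^sub>0 + 1" i] that by auto
  hence fin: "finite (Omega M)"
    unfolding Omega by (auto intro: poly_roots_finite)
  have "l = 0" using assms(5,6) by (simp add: complex_eq_iff)
  hence "poly (char_poly ?S) 0 = 0"
    using assms(4) unfolding leading_eigenvalue_def eigenvalue_root_char_poly[OF S] by simp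
  hence zero: "coeff (char_poly ?S) 0 = 0" by (simp add: poly_0_coeff_0)
  hence "poly (sigma_coeff M 0) \<sigma>\<^sub>0 = 0"
    by (simp add: coeff_char_poly_sigma_mat[OF assms(1)] poly_map_poly_of_real)
  \<comment> \<open>Index 0 must be admissible in \<open>Omega M\<close>. For \<open>n = 0\<close>
    the characteristic polynomial is monic of degree 0, so its constant coefficient would be
    1.\<close>
  moreover have "n > 0"
    using zero degree_monic_char_poly[OF S] by (cases n) auto
  ultimately have mem: "\<sigma>\<^sub>0 \<in> Omega M" unfolding Omega by auto
  have "x \<le> \<sigma>\<^sub>0" if "x \<in> Omega M" for x
    using that nonzero[of x] unfolding Omega by (auto simp: not_less[symmetric])
  hence "Max (Omega M) = \<sigma>\<^sub>0" using fin mem by (intro Max_eqI) auto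
  thus ?thesis using fin mem by auto
qed

end
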